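(* Let $X$ be a multi-set and let $\tau$ be an integer. Suppose that for any $1 < d \le \tau$ the multi-set $X$ contains $d$ numbers not divisible by $d$, that is, $|\overline{X(d)}| \ge d$. Then for any $1 \le d \le \tau$ the set $\mathcal{S}(X)$ is $d$-complete, that is, $\mathcal{S}(X) \bmod d = \mathbb{Z}_d$.
   Context: $X$ is a finite non-empty multi-set of positive integers; $\mathcal{S}(X) := \{\Sigma(Y)\mid Y\subseteq X\}$ is the set of all subset sums, where $\Sigma(Y)$ is the sum of the elements of $Y$ (with multiplicity). For an integer $d$, $X(d) := X\cap d\mathbb{Z}$ and $\overline{X(d)} := X\setminus X(d)$; $|\cdot|$ counts with multiplicity. For a set $A$, $A\bmod d := \{a\bmod d\mid a\in A\}$. *)

theory Defs
  imports "HOL-Library.Multiset"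
begin

definition subset_sums :: "int multiset \<Rightarrow> int set" where
  "subset_sums X = {\<Sum>\<^sub># Y | Y. Y \<subseteq># X}"

definition divisible_part :: "int multiset \<Rightarrow> int \<Rightarrow> int multiset" where
  "divisible_part X d = {#x \<in># X. d dvd x#}"

definition nondivisible_part :: "int multiset \<Rightarrow> int \<Rightarrow> int multiset" where
  "nondivisible_part X d = X - divisible_part X d"

definition set_mod :: "int set \<Rightarrow> int \<Rightarrow> int set" where
  "set_mod A d = {a mod d | a. a \<in> A}"

(* The residues modulo d are represented by {0..<d}, which is the range of
   "_ mod d" for d > 0; the notion is only meant for positive d. *)
definition complete_mod :: "int \<Rightarrow> int set \<Rightarrow> bool" where
  "complete_mod d A \<longleftrightarrow> set_mod A d = {0..<d}"

end

theory Submission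
  imports Defs
begin

text \<open>
  Let \<open>A\<close> be the set of integers congruent modulo \<open>d\<close> to a subset sum of \<open>X\<close>, and let \<open>e\<close> be
  its least positive period; then \<open>e \<le> d\<close>, and \<open>e\<close> divides every period of \<open>A\<close>.
  For a part \<open>Y + {x}\<close> of \<open>X\<close>, if \<open>S(Y) + x\<close> were contained in \<open>S(Y)\<close> modulo \<open>e\<close>, then \<open>x\<close> would
  be a period of \<open>A\<close>, because \<open>S(X) = S(Y) + S(X - Y)\<close>, and hence a multiple of \<open>e\<close>. So, adding the
  elements of \<open>X\<close> one by one, each element not divisible by \<open>e\<close> strictly enlarges the set of
  subset sums modulo \<open>e\<close>. If \<open>e > 1\<close>, there are at least \<open>e\<close> such elements, which gives more than
  \<open>e\<close> residues modulo \<open>e\<close>. Hence \<open>e = 1\<close> and \<open>A\<close> contains all integers.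
\<close>

lemma size_nondivisible_part:
  "size (nondivisible_part X d) = size {#x \<in># X. \<not> d dvd x#}"
proof -
  have "X = divisible_part X d + {#x \<in># X. \<not> d dvd x#}"
    unfolding divisible_part_def by (rule multiset_partition)
  then show ?thesis
    unfolding nondivisible_part_def by (metis add_diff_cancel_left')
qed

lemma zero_in_subset_sums: "0 \<in> subset_sums X"
  unfolding subset_sums_def by (force intro: exI[of _ "{#}"])

lemma subset_sums_empty: "subset_sums {#} = {0}"
  unfolding subset_sums_def by auto

lemma subset_sums_union:
  "subset_sums (X + Y) = {s + t | s t. s \<in> subset_sums X \<and> t \<in> subset_sums Y}"
proof (intro equalityI subsetI)
  fix a assume "a \<in> subset_sums (X + Y)"
  then obtain Z where Z: "Z \<subseteq># X + Y" "a = \<Sum>\<^sub># Z"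
    unfolding subset_sums_def by blast
  \<comment> \<open>A part of the union is split greedily: as many copies as possible are charged to
    \<open>X\<close>, so that the excess fits into \<open>Y\<close>.\<close>
  have "Z = Z \<inter># X + (Z - X)"
    by (rule multiset_eqI) simp
  then have "a = \<Sum>\<^sub># (Z \<inter># X) + \<Sum>\<^sub># (Z - X)"
    using Z(2) by (metis sum_mset.union)
  moreover have "Z \<inter># X \<subseteq># X" "Z - X \<subseteq># Y"
    using Z(1) by (simp_all add: subset_eq_diff_conv add.commute)
  ultimately show "a \<in> {s + t | s t. s \<in> subset_sums X \<and> t \<in> subset_sums Y}"
    unfolding subset_sums_def by blast
next
  fix a assume "a \<in> {s + t | s t. s \<in> subset_sums X \<and> t \<in> subset_sums Y}"
  then obtain U V where "U \<subseteq># X" "V \<subseteq># Y" "a = \<Sum>\<^sub># (U + V)"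
    unfolding subset_sums_def by fastforce
  then show "a \<in> subset_sums (X + Y)"
    unfolding subset_sums_def using subset_mset.add_mono by blast
qed

lemma subset_sums_add_mset:
  "subset_sums (add_mset x Y) = subset_sums Y \<union> (\<lambda>s. s + x) ` subset_sums Y"
proof -
  have "Y \<subseteq># {#x#} \<longleftrightarrow> Y = {#} \<or> Y = {#x#}" for Y
    by (cases Y) auto
  then have "subset_sums {#x#} = sum_mset ` {{#}, {#x#}}"
    unfolding subset_sums_def by blast
  then have "subset_sums {#x#} = {0, x}"
    by simp
  then show ?thesis
    using subset_sums_union[of Y "{#x#}"] by auto (metis add_0_right)
qed

lemma set_mod_subset: "0 < d \<Longrightarrow> set_mod A d \<subseteq> {0..<d}"
  unfolding set_mod_def by auto

text \<open>Each element not divisible by \<open>e\<close> contributes a new residue when it is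
  added; the inequality is strict because the empty sum already occupies the residue 0. Quantifying
  over all parts of \<open>X\<close> lets the growth condition pass to smaller multisets in the
  induction.\<close>

lemma card_subset_sums_mod_gt:
  fixes e :: int
  assumes "0 < e"
    and "\<And>x Y. add_mset x Y \<subseteq># X \<Longrightarrow> \<not> e dvd x \<Longrightarrow>
      \<exists>s\<in>subset_sums Y. (s + x) mod e \<notin> set_mod (subset_sums Y) e"
  shows "size {#x \<in># X. \<not> e dvd x#} < card (set_mod (subset_sums X) e)"
  using assms(2)
proof (induction X)
  case empty
  then show ?case by (simp add: subset_sums_empty set_mod_def)
next
  case (add x X)
  have fin: "finite (set_mod (subset_sums Y) e)" for Y
    using set_mod_subset[OF assms(1)] finite_subset by blast
  have sub: "set_mod (subset_sums X) e \<subseteq> set_mod (subset_sums (add_mset x X)) e"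
    unfolding set_mod_def subset_sums_add_mset by blast
  have IH: "size {#x \<in># X. \<not> e dvd x#} < card (set_mod (subset_sums X) e)"
  proof (rule add.IH)
    fix y Y assume "add_mset y Y \<subseteq># X" "\<not> e dvd y"
    moreover have "X \<subseteq># add_mset x X" by simp
    ultimately show "\<exists>s\<in>subset_sums Y. (s + y) mod e \<notin> set_mod (subset_sums Y) e"
      using add.prems subset_mset.order_trans by blast
  qed
  show ?case
  proof (cases "e dvd x")
    case True
    then show ?thesis
      using IH card_mono[OF fin sub] by simp
  next
    case False
    then obtain s where s: "s \<in> subset_sums X" "(s + x) mod e \<notin> set_mod (subset_sums X) e"
      using add.prems by blast
    have "(s + x) mod e \<in> set_mod (subset_sums (add_mset x X)) e"
      using s(1) unfolding set_mod_def subset_sums_add_mset by blast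
    then have "card (set_mod (subset_sums X) e) < card (set_mod (subset_sums (add_mset x X)) e)"
      using s(2) sub by (intro psubset_card_mono[OF fin]) blast
    then show ?thesis
      using IH False by simp
  qed
qed

lemma subset_sums_complete_mod:
  fixes d :: int
  assumes "0 < d"
    and large: "\<And>e. 1 < e \<Longrightarrow> e \<le> d \<Longrightarrow> e \<le> int (size (nondivisible_part X e))"
  shows "complete_mod d (subset_sums X)"
proof -
  define A where "A = {a. a mod d \<in> set_mod (subset_sums X) d}"
  \<comment> \<open>Only translation by \<open>h\<close> into \<open>A\<close> is demanded;
    translation by \<open>-h\<close> comes from \<open>period_mult\<close> with factor -1.\<close>
  define period where "period h \<longleftrightarrow> (\<forall>a\<in>A. a + h \<in> A)" for h
  have SA: "s \<in> A" if "s \<in> subset_sums X" for s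
    using that unfolding A_def set_mod_def by blast
  have period_dvd: "period h" if "d dvd h" for h
    using that unfolding period_def A_def by auto
  have period_add: "period (h + k)" if "period h" "period k" for h k
    using that unfolding period_def by (simp flip: add.assoc)
  have period_nat: "period (int n * h)" if "period h" for n h
    by (induction n) (use that period_dvd[of 0] in \<open>auto simp: distrib_right intro: period_add\<close>)
  have period_mult: "period (k * h)" if "period h" for k h
  proof -
    \<comment> \<open>Negative multiples reduce to nonnegative ones because \<open>d\<close> is a period in both directions.\<close>
    have "period (int (nat (k mod d)) * h + d * (k div d * h))"
      by (rule period_add[OF period_nat[OF that] period_dvd]) simp
    moreover have "int (nat (k mod d)) * h + d * (k div d * h) = (k mod d + d * (k div d)) * h"
      using assms(1) by (simp only: distrib_right mult.assoc) simp
    ultimately show ?thesis by (simp only: mod_mult_div_eq)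
  qed

  define n where "n = (LEAST n. 0 < n \<and> period (int n))"
  define e where "e = int n"
  have d: "0 < nat d \<and> period (int (nat d))"
    using assms(1) period_dvd by simp
  have n: "0 < n \<and> period (int n)"
    unfolding n_def using d by (rule LeastI)
  have "n \<le> nat d"
    unfolding n_def using d by (rule Least_le)
  then have e: "0 < e" "period e" "e \<le> d"
    using n assms(1) unfolding e_def by auto
  \<comment> \<open>Otherwise the remainder of \<open>x\<close> modulo \<open>e\<close> would be a
    positive period below the least one.\<close>
  have e_dvd: "e dvd x" if "period x" for x
  proof (rule ccontr)
    assume "\<not> e dvd x"
    then have "0 < nat (x mod e)"
      using pos_mod_sign[OF e(1), of x] by (simp add: dvd_eq_mod_eq_0)
    moreover have "period (x + (- (x div e)) * e)"
      by (intro period_add period_mult that e(2))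
    then have "period (int (nat (x mod e)))"
      using e(1) by (simp add: minus_div_mult_eq_mod)
    ultimately have "n \<le> nat (x mod e)"
      unfolding n_def by (intro Least_le) simp
    then show False
      using pos_mod_bound[OF e(1), of x] pos_mod_sign[OF e(1), of x] unfolding e_def by linarith
  qed

  have growth: "\<exists>s\<in>subset_sums Y. (s + x) mod e \<notin> set_mod (subset_sums Y) e"
    if sub: "add_mset x Y \<subseteq># X" and ndvd: "\<not> e dvd x" for x Y
  proof (rule ccontr)
    assume "\<not> ?thesis"
    then have shift: "\<exists>t\<in>subset_sums Y. (s + x) mod e = t mod e" if "s \<in> subset_sums Y" for s
      using that unfolding set_mod_def by blast
    have "Y \<subseteq># X"
      using sub by (meson mset_subset_eq_insertD subset_mset.less_imp_le)
    then obtain Z where X: "X = Y + Z"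
      by (auto simp: subset_mset.le_iff_add)
    have "period x"
      unfolding period_def
    proof
      fix a assume "a \<in> A"
      then obtain r where r: "r \<in> subset_sums X" "a mod d = r mod d"
        unfolding A_def set_mod_def by blast
      then obtain s z where sz: "s \<in> subset_sums Y" "z \<in> subset_sums Z" "r = s + z"
        unfolding X subset_sums_union by blast
      \<comment> \<open>Trading \<open>s + x\<close> for \<open>t\<close> leaves a true subset sum
        \<open>t + z\<close>, which differs from \<open>a + x\<close> by a multiple of
        \<open>e\<close> plus a multiple of \<open>d\<close>, both periods.\<close>
      obtain t where t: "t \<in> subset_sums Y" "(s + x) mod e = t mod e"
        using shift[OF sz(1)] by blast
      have "t + z \<in> A"
        using t(1) sz(2) by (intro SA) (auto simp: X subset_sums_union)
      moreover obtain k where "s + x - t = e * k"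
        using t(2) by (auto simp: mod_eq_dvd_iff elim: dvdE)
      then have "period (s + x - t)"
        using period_mult[OF e(2), of k] by (simp add: mult.commute)
      moreover have "period (a - r)"
        using r(2) by (intro period_dvd) (simp add: mod_eq_dvd_iff)
      ultimately have "t + z + (s + x - t) + (a - r) \<in> A"
        unfolding period_def by blast
      then show "a + x \<in> A"
        using sz(3) by (simp add: algebra_simps)
    qed
    then show False
      using e_dvd ndvd by blast
  qed

  have "size {#x \<in># X. \<not> e dvd x#} < card (set_mod (subset_sums X) e)"
    using e(1) growth by (rule card_subset_sums_mod_gt)
  also have "\<dots> \<le> nat e"
    using card_mono[OF _ set_mod_subset[OF e(1)]] by simp
  finally have "int (size (nondivisible_part X e)) < e"
    unfolding size_nondivisible_part by linarith
  \<comment> \<open>Since \<open>e \<le> d\<close>, any \<open>e\<close> above 1 would fall under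
    \<open>large\<close>.\<close>
  then have "e = 1"
    using large[of e] e(1,3) by force
  then have all: "period r" for r
    using period_mult[OF e(2), of r] by simp
  \<comment> \<open>The empty sum puts 0 into \<open>A\<close>, and every integer is now a
    period.\<close>
  have "0 + r \<in> A" for r
    using all[of r] SA[OF zero_in_subset_sums] unfolding period_def by blast
  then have "r mod d \<in> set_mod (subset_sums X) d" for r
    unfolding A_def by simp
  then have "{0..<d} \<subseteq> set_mod (subset_sums X) d"
    by (metis atLeastLessThan_iff mod_pos_pos_trivial subsetI)
  then show ?thesis
    unfolding complete_mod_def using set_mod_subset[OF assms(1)] by blast
qed

theorem theorem4p13:
  fixes X :: "int multiset" and \<tau> :: int
  assumes "X \<noteq> {#}"
    and "\<forall>x \<in># X. 0 < x"
    and "\<forall>d. 1 < d \<and> d \<le> \<tau> \<longrightarrow> int (size (nondivisible_part X d)) \<ge> d"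
  shows "\<forall>d. 1 \<le> d \<and> d \<le> \<tau> \<longrightarrow> complete_mod d (subset_sums X)"
  using assms(3) by (auto intro!: subset_sums_complete_mod)

end
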